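(* Let $X$ and $Y$ be uniformly discrete metric spaces of bounded geometry. The family $\{M_{[d]}\}_{[d]\in D(X,Y)}$ is compatible with the partial order on $D(X,Y)$; that is, if $[d_1]\le[d_2]$ in $D(X,Y)$ then $M_{[d_1]}\subset M_{[d_2]}$.
   Context: $X$ is uniformly discrete if $\inf_{x\ne x'}d_X(x,x')>0$; it has bounded geometry if for every $R>0$ there is $C>0$ such that every ball of radius $R$ has at most $C$ points. $\mathcal D(X,Y)$ is the set of metrics $d$ on $X\sqcup Y$ such that $d|_X=d_X$, $d|_Y=d_Y$ and $\inf_{x\in X,y\in Y}d(x,y)>0$. Metrics $d_1,d_2\in\mathcal D(X,Y)$ are coarsely equivalent if there is a homeomorphism $\phi$ of $[0,\infty)$ with $\phi^{-1}(d_1(x,y))\le d_2(x,y)\le\phi(d_1(x,y))$ for all $x\in X$, $y\in Y$. $D(X,Y)$ is the set of coarse equivalence classes $[d]$, with partial order: $[d_1]\le[d_2]$ if there is a homeomorphism $\phi$ of $[0,\infty)$ such that $d_2(x,y)\le\phi(d_1(x,y))$ for all $x\in X$, $y\in Y$. $H_X=l_2(X)$, $H_Y=l_2(Y)$ with standard bases $\delta_x$, $\delta_y$. A bounded operator $S:H_X\to H_Y$ has propagation $\le L$ with respect to $d$ if $S_{yx}=\langle\delta_y,S\delta_x\rangle\neq0$ implies $d(x,y)\le L$. $M_{[d]}$ is the norm closure in $\mathbb B(H_X,H_Y)$ of the set of operators of finite propagation with respect to $d$. *)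

theory Defs
  imports "HOL-Analysis.Analysis"
begin

section \<open>The complex Hilbert space $l_2(X)$\<close>

typedef 'a ell2 = "{f :: 'a \<Rightarrow> complex. (\<lambda>x. (cmod (f x))\<^sup>2) summable_on UNIV}"
  morphisms ell2_nth Abs_ell2
  by (rule exI[of _ "\<lambda>_. 0"]) simp

setup_lifting type_definition_ell2

lemma ell2_summable: "(\<lambda>x. (cmod (ell2_nth f x))\<^sup>2) summable_on UNIV"
  using ell2_nth[of f] by simp

lemma square_summable_product:
  fixes f g :: "'a \<Rightarrow> complex"
  assumes "(\<lambda>x. (cmod (f x))\<^sup>2) summable_on UNIV" "(\<lambda>x. (cmod (g x))\<^sup>2) summable_on UNIV"
  shows "(\<lambda>x. cnj (f x) * g x) summable_on UNIV"
proof (rule abs_summable_summable, rule summable_on_comparison_test)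
  show "(\<lambda>x. (cmod (f x))\<^sup>2 + (cmod (g x))\<^sup>2) summable_on UNIV"
    using assms by (rule summable_on_add)
next
  fix x
  have "2 * (cmod (f x) * cmod (g x)) \<le> (cmod (f x))\<^sup>2 + (cmod (g x))\<^sup>2"
    using sum_squares_bound[of "cmod (f x)" "cmod (g x)"] by (simp add: mult.assoc)
  moreover have "0 \<le> cmod (f x) * cmod (g x)"
    by simp
  ultimately have "cmod (f x) * cmod (g x) \<le> (cmod (f x))\<^sup>2 + (cmod (g x))\<^sup>2"
    by linarith
  then show "norm (cnj (f x) * g x) \<le> (cmod (f x))\<^sup>2 + (cmod (g x))\<^sup>2"
    by (simp add: norm_mult)
qed simp

lemma square_summable_add:
  fixes f g :: "'a \<Rightarrow> complex"
  assumes "(\<lambda>x. (cmod (f x))\<^sup>2) summable_on UNIV" "(\<lambda>x. (cmod (g x))\<^sup>2) summable_on UNIV"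
  shows "(\<lambda>x. (cmod (f x + g x))\<^sup>2) summable_on UNIV"
proof (rule summable_on_comparison_test)
  show "(\<lambda>x. 2 * ((cmod (f x))\<^sup>2 + (cmod (g x))\<^sup>2)) summable_on UNIV"
    using assms by (intro summable_on_cmult_right summable_on_add)
next
  fix x
  have "(cmod (f x + g x))\<^sup>2 \<le> (cmod (f x) + cmod (g x))\<^sup>2"
    by (intro power_mono norm_triangle_ineq norm_ge_zero)
  also have "\<dots> \<le> 2 * ((cmod (f x))\<^sup>2 + (cmod (g x))\<^sup>2)"
    using sum_squares_bound[of "cmod (f x)" "cmod (g x)"] by (simp add: power2_sum)
  finally show "(cmod (f x + g x))\<^sup>2 \<le> 2 * ((cmod (f x))\<^sup>2 + (cmod (g x))\<^sup>2)" .
qed simp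

lemma square_summable_scale:
  fixes f :: "'a \<Rightarrow> complex"
  assumes "(\<lambda>x. (cmod (f x))\<^sup>2) summable_on UNIV"
  shows "(\<lambda>x. (cmod (c * f x))\<^sup>2) summable_on UNIV"
  using summable_on_cmult_right[OF assms, of "(cmod c)\<^sup>2"]
  by (simp add: norm_mult power_mult_distrib)

lift_definition scaleC_ell2 :: "complex \<Rightarrow> 'a ell2 \<Rightarrow> 'a ell2" is "\<lambda>c f x. c * f x"
  using square_summable_scale by fast

text \<open>The inner product is conjugate-linear in the first argument.\<close>

definition cinner_ell2 :: "'a ell2 \<Rightarrow> 'a ell2 \<Rightarrow> complex" where
  "cinner_ell2 f g = (\<Sum>\<^sub>\<infinity>x. cnj (ell2_nth f x) * ell2_nth g x)"

lift_definition delta :: "'a \<Rightarrow> 'a ell2" is "\<lambda>x y. if y = x then 1 else 0"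
proof -
  fix x :: 'a
  show "(\<lambda>y. (cmod (if y = x then 1 else 0))\<^sup>2) summable_on UNIV"
    by (rule finite_nonzero_values_imp_summable_on, rule finite_subset[of _ "{x}"]) auto
qed

instantiation ell2 :: (type) real_inner
begin

lift_definition zero_ell2 :: "'a ell2" is "\<lambda>_. 0" by simp

lift_definition plus_ell2 :: "'a ell2 \<Rightarrow> 'a ell2 \<Rightarrow> 'a ell2" is "\<lambda>f g x. f x + g x"
  using square_summable_add by fast

lift_definition uminus_ell2 :: "'a ell2 \<Rightarrow> 'a ell2" is "\<lambda>f x. - f x" by simp

lift_definition minus_ell2 :: "'a ell2 \<Rightarrow> 'a ell2 \<Rightarrow> 'a ell2" is "\<lambda>f g x. f x - g x"
proof -
  fix f g :: "'a \<Rightarrow> complex"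
  assume "(\<lambda>x. (cmod (f x))\<^sup>2) summable_on UNIV" "(\<lambda>x. (cmod (g x))\<^sup>2) summable_on UNIV"
  then show "(\<lambda>x. (cmod (f x - g x))\<^sup>2) summable_on UNIV"
    using square_summable_add[of f "\<lambda>x. - g x"] by simp
qed

lift_definition scaleR_ell2 :: "real \<Rightarrow> 'a ell2 \<Rightarrow> 'a ell2" is "\<lambda>r f x. r *\<^sub>R f x"
  unfolding scaleR_conv_of_real using square_summable_scale by fast

definition inner_ell2 :: "'a ell2 \<Rightarrow> 'a ell2 \<Rightarrow> real" where
  "inner_ell2 f g = Re (cinner_ell2 f g)"

definition norm_ell2 :: "'a ell2 \<Rightarrow> real" where
  "norm_ell2 f = sqrt (\<Sum>\<^sub>\<infinity>x. (cmod (ell2_nth f x))\<^sup>2)"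

definition sgn_ell2 :: "'a ell2 \<Rightarrow> 'a ell2" where
  "sgn_ell2 f = inverse (norm f) *\<^sub>R f"

definition dist_ell2 :: "'a ell2 \<Rightarrow> 'a ell2 \<Rightarrow> real" where
  "dist_ell2 f g = norm (f - g)"

definition uniformity_ell2 :: "('a ell2 \<times> 'a ell2) filter" where
  "uniformity_ell2 = (INF e\<in>{0<..}. principal {(f, g). dist f g < e})"

definition open_ell2 :: "'a ell2 set \<Rightarrow> bool" where
  "open_ell2 U \<longleftrightarrow> (\<forall>x\<in>U. \<forall>\<^sub>F (x', y) in uniformity. x' = x \<longrightarrow> y \<in> U)"

instance
proof
  have summ: "(\<lambda>x. cnj (ell2_nth f x) * ell2_nth g x) summable_on UNIV" for f g :: "'a ell2"
    by (intro square_summable_product ell2_summable)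
  have self: "inner f f = (\<Sum>\<^sub>\<infinity>x. (cmod (ell2_nth f x))\<^sup>2)" for f :: "'a ell2"
  proof -
    have "Re (cnj z * z) = (cmod z)\<^sup>2" for z
      unfolding cmod_power2 by (simp add: power2_eq_square)
    then show ?thesis
      unfolding inner_ell2_def cinner_ell2_def by (simp flip: infsum_Re[OF summ])
  qed
  fix f g h :: "'a ell2" and a b r :: real
  show "f + g + h = f + (g + h)" by transfer (simp add: add.assoc)
  show "f + g = g + f" by transfer (simp add: add.commute)
  show "0 + f = f" by transfer simp
  show "- f + f = 0" by transfer simp
  show "f - g = f + - g" by transfer simp
  show "a *\<^sub>R (f + g) = a *\<^sub>R f + a *\<^sub>R g" by transfer (simp add: scaleR_add_right)
  show "(a + b) *\<^sub>R f = a *\<^sub>R f + b *\<^sub>R f" by transfer (simp add: scaleR_add_left)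
  show "a *\<^sub>R b *\<^sub>R f = (a * b) *\<^sub>R f" by transfer simp
  show "1 *\<^sub>R f = f" by transfer simp
  show "dist f g = norm (f - g)" by (rule dist_ell2_def)
  show "sgn f = inverse (norm f) *\<^sub>R f" by (rule sgn_ell2_def)
  show "uniformity = (INF e\<in>{0<..}. principal {(f :: 'a ell2, g). dist f g < e})"
    by (rule uniformity_ell2_def)
  show "open U \<longleftrightarrow> (\<forall>x\<in>U. \<forall>\<^sub>F (x', y) in uniformity. x' = x \<longrightarrow> y \<in> U)" for U :: "'a ell2 set"
    by (rule open_ell2_def)
  have "cinner_ell2 g f = cnj (cinner_ell2 f g)"
    unfolding cinner_ell2_def by (simp flip: infsum_cnj add: mult.commute)
  then show "inner f g = inner g f"
    unfolding inner_ell2_def by simp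
  have "cinner_ell2 (f + g) h = cinner_ell2 f h + cinner_ell2 g h"
    unfolding cinner_ell2_def
    by (simp add: plus_ell2.rep_eq distrib_right infsum_add[OF summ summ])
  then show "inner (f + g) h = inner f h + inner g h"
    unfolding inner_ell2_def by simp
  have "cinner_ell2 (r *\<^sub>R f) g = of_real r * cinner_ell2 f g"
    unfolding cinner_ell2_def
    by (simp add: scaleR_ell2.rep_eq scaleR_conv_of_real mult.assoc infsum_cmult_right[OF summ])
  then show "inner (r *\<^sub>R f) g = r * inner f g"
    unfolding inner_ell2_def by simp
  show "0 \<le> inner f f"
    unfolding self by (rule infsum_nonneg) simp
  show "inner f f = 0 \<longleftrightarrow> f = 0"
  proof
    assume "inner f f = 0"
    then have "(\<Sum>\<^sub>\<infinity>x. (cmod (ell2_nth f x))\<^sup>2) \<le> 0"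
      unfolding self by simp
    then have "(cmod (ell2_nth f x))\<^sup>2 = 0" for x
      using nonneg_infsum_le_0D[OF _ ell2_summable, of f x] by simp
    then show "f = 0"
      by (simp add: ell2_nth_inject[symmetric] zero_ell2.rep_eq fun_eq_iff)
  next
    assume "f = 0"
    then show "inner f f = 0"
      unfolding self by (simp add: zero_ell2.rep_eq)
  qed
  show "norm f = sqrt (inner f f)"
    unfolding self by (rule norm_ell2_def)
qed

end


section \<open>Bounded operators\<close>

text \<open>
  The library type of bounded operators consists of the real-linear ones; $B(H_X,H_Y)$ is the
  subspace of those that are complex-linear. Its norm is the operator norm of the ambient type.
\<close>

definition bounded_operators :: "('x ell2 \<Rightarrow>\<^sub>L 'y ell2) set" where
  "bounded_operators =
    {S. \<forall>c f. blinfun_apply S (scaleC_ell2 c f) = scaleC_ell2 c (blinfun_apply S f)}"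

definition matrix_coeff :: "('x ell2 \<Rightarrow>\<^sub>L 'y ell2) \<Rightarrow> 'y \<Rightarrow> 'x \<Rightarrow> complex" where
  "matrix_coeff S y x = cinner_ell2 (delta y) (blinfun_apply S (delta x))"


section \<open>Bounded geometry and metrics on the disjoint union\<close>

definition bounded_geometry :: "'a::metric_space itself \<Rightarrow> bool" where
  "bounded_geometry _ \<longleftrightarrow>
    (\<forall>R>0. \<exists>C>0. \<forall>x::'a. finite (cball x R) \<and> card (cball x R) \<le> (C::nat))"

type_synonym ('x, 'y) sum_metric = "'x + 'y \<Rightarrow> 'x + 'y \<Rightarrow> real"

definition union_metrics :: "('x::metric_space, 'y::metric_space) sum_metric set" where
  "union_metrics =
    {d. Metric_space UNIV d \<and>
        (\<forall>x x'. d (Inl x) (Inl x') = dist x x') \<and>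
        (\<forall>y y'. d (Inr y) (Inr y') = dist y y') \<and>
        (INF (x, y)\<in>UNIV. d (Inl x) (Inr y)) > 0}"

definition coarsely_equivalent ::
    "(('x::metric_space, 'y::metric_space) sum_metric \<times> ('x, 'y) sum_metric) set" where
  "coarsely_equivalent =
    {(d1, d2). d1 \<in> union_metrics \<and> d2 \<in> union_metrics \<and>
      (\<exists>\<phi> \<phi>_inv. homeomorphism {0..} {0..} \<phi> \<phi>_inv \<and>
        (\<forall>x y. \<phi>_inv (d1 (Inl x) (Inr y)) \<le> d2 (Inl x) (Inr y) \<and>
               d2 (Inl x) (Inr y) \<le> \<phi> (d1 (Inl x) (Inr y))))}"

text \<open>The set $D(X,Y)$ of coarse equivalence classes.\<close>

definition metric_classes :: "('x::metric_space, 'y::metric_space) sum_metric set set" where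
  "metric_classes = union_metrics // coarsely_equivalent"

text \<open>
  The order on classes, defined through representatives. It does not depend on their choice, so
  it suffices that some pair of representatives satisfies the inequality.
\<close>

definition class_le ::
    "('x::metric_space, 'y::metric_space) sum_metric set \<Rightarrow> ('x, 'y) sum_metric set \<Rightarrow> bool" where
  "class_le c1 c2 \<longleftrightarrow>
    (\<exists>d1\<in>c1. \<exists>d2\<in>c2. \<exists>\<phi> \<phi>_inv. homeomorphism {0..} {0..} \<phi> \<phi>_inv \<and>
      (\<forall>x y. d2 (Inl x) (Inr y) \<le> \<phi> (d1 (Inl x) (Inr y))))"


section \<open>Operators of finite propagation\<close>

definition propagation_le :: "('x, 'y) sum_metric \<Rightarrow> real \<Rightarrow> ('x ell2 \<Rightarrow>\<^sub>L 'y ell2) \<Rightarrow> bool" where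
  "propagation_le d L S \<longleftrightarrow> (\<forall>x y. matrix_coeff S y x \<noteq> 0 \<longrightarrow> d (Inl x) (Inr y) \<le> L)"

definition M_metric :: "('x, 'y) sum_metric \<Rightarrow> ('x ell2 \<Rightarrow>\<^sub>L 'y ell2) set" where
  "M_metric d =
    top_of_set bounded_operators closure_of {S \<in> bounded_operators. \<exists>L. propagation_le d L S}"

text \<open>
  \<open>M_class c\<close> is the common value of \<open>M_metric d\<close> for the representatives \<open>d\<close> of \<open>c\<close>.
\<close>

definition M_class :: "('x, 'y) sum_metric set \<Rightarrow> ('x ell2 \<Rightarrow>\<^sub>L 'y ell2) set" where
  "M_class c = the_elem (M_metric ` c)"

end

theory Submission
  imports Defs
begin

text \<open>If \<open>d2\<close> \<le> \<phi>(\<open>d1\<close>) on cross pairs and \<phi> is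
  continuous on [0,\<infinity>), then \<phi> is bounded on [0,L] by compactness, so an operator of
  \<open>d1\<close>-propagation at most L has \<open>d2\<close>-propagation at most that bound. Thus
  the finite propagation operators for \<open>d1\<close> are among those for \<open>d2\<close>, and
  taking closures preserves the inclusion (\<open>M_metric_mono_upper_control\<close>). To pass to
  classes, the two bounds in a coarse equivalence give opposite inclusions, so
  \<open>M_metric\<close> is constant on each class and \<open>M_class\<close> can be computed on
  any representative (\<open>M_class_eq\<close>).\<close>

lemma continuous_halfline_bounded_above:
  fixes \<phi> :: "real \<Rightarrow> real"
  assumes "continuous_on {0..} \<phi>"
  obtains B where "\<And>t. 0 \<le> t \<Longrightarrow> t \<le> L \<Longrightarrow> \<phi> t \<le> B"
proof -
  have "continuous_on {0..L} \<phi>"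
    using assms by (rule continuous_on_subset) auto
  then have "bounded (\<phi> ` {0..L})"
    by (intro compact_imp_bounded compact_continuous_image) auto
  then obtain B where "\<forall>t\<in>{0..L}. \<bar>\<phi> t\<bar> \<le> B"
    by (auto simp: bounded_iff)
  then show ?thesis
    by (intro that[of B]) force
qed

lemma union_metrics_nonneg: "d \<in> union_metrics \<Longrightarrow> 0 \<le> d u v"
  by (auto simp: union_metrics_def intro: Metric_space.nonneg)

text \<open>The metric enters \<open>M_metric\<close> only through which families of cross pairs
  have bounded distance, so comparing these families suffices; the new bound may depend on L in any
  way.\<close>

lemma M_metric_mono:
  assumes "\<And>L. \<exists>L'. \<forall>x y. d1 (Inl x) (Inr y) \<le> L \<longrightarrow> d2 (Inl x) (Inr y) \<le> L'"
  shows "M_metric d1 \<subseteq> M_metric d2"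
proof -
  have "\<exists>L'. propagation_le d2 L' S" if "propagation_le d1 L S" for L S
    using that assms[of L] unfolding propagation_le_def by meson
  then show ?thesis
    unfolding M_metric_def by (intro closure_of_mono) blast
qed

lemma M_metric_mono_upper_control:
  assumes "d1 \<in> union_metrics" and "continuous_on {0..} \<phi>"
    and le: "\<And>x y. d2 (Inl x) (Inr y) \<le> \<phi> (d1 (Inl x) (Inr y))"
  shows "M_metric d1 \<subseteq> M_metric d2"
proof (rule M_metric_mono)
  fix L
  obtain B where "\<And>t. 0 \<le> t \<Longrightarrow> t \<le> L \<Longrightarrow> \<phi> t \<le> B"
    using continuous_halfline_bounded_above assms(2) by blast
  then show "\<exists>L'. \<forall>x y. d1 (Inl x) (Inr y) \<le> L \<longrightarrow> d2 (Inl x) (Inr y) \<le> L'"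
    using le union_metrics_nonneg[OF assms(1)] order_trans by metis
qed

text \<open>A lower bound through \<psi> is turned into an upper bound on \<open>d1\<close> by its
  inverse \<phi>. Boundedness of \<phi> on [0,L] does the work that monotonicity of \<phi> would
  do.\<close>

lemma M_metric_mono_lower_control:
  assumes "d1 \<in> union_metrics" and hom: "homeomorphism {0..} {0..} \<phi> \<psi>"
    and le: "\<And>x y. \<psi> (d1 (Inl x) (Inr y)) \<le> d2 (Inl x) (Inr y)"
  shows "M_metric d2 \<subseteq> M_metric d1"
proof (rule M_metric_mono)
  fix L
  have "continuous_on {0..} \<phi>"
    using hom by (simp add: homeomorphism_def)
  then obtain B where B: "\<And>t. 0 \<le> t \<Longrightarrow> t \<le> L \<Longrightarrow> \<phi> t \<le> B"
    using continuous_halfline_bounded_above by blast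
  have "d1 (Inl x) (Inr y) \<le> B" if "d2 (Inl x) (Inr y) \<le> L" for x y
  proof -
    let ?r = "d1 (Inl x) (Inr y)"
    have "0 \<le> ?r"
      using assms(1) by (rule union_metrics_nonneg)
    \<comment> \<open>The point \<psi>(r) lies in [0,L], and \<phi> sends it back to r, so the bound
      B for \<phi> there is a bound for r.\<close>
    then have "0 \<le> \<psi> ?r" and "\<phi> (\<psi> ?r) = ?r"
      using hom by (auto simp: homeomorphism_def)
    moreover have "\<psi> ?r \<le> L"
      using le that by (rule order_trans)
    ultimately show ?thesis
      using B[of "\<psi> ?r"] by simp
  qed
  then show "\<exists>L'. \<forall>x y. d2 (Inl x) (Inr y) \<le> L \<longrightarrow> d1 (Inl x) (Inr y) \<le> L'"
    by blast
qed

lemma M_metric_coarsely_equivalent: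
  assumes "(d1, d2) \<in> coarsely_equivalent"
  shows "M_metric d1 = M_metric d2"
proof -
  from assms obtain \<phi> \<psi> where d1: "d1 \<in> union_metrics"
    and hom: "homeomorphism {0..} {0..} \<phi> \<psi>"
    and le: "\<And>x y. \<psi> (d1 (Inl x) (Inr y)) \<le> d2 (Inl x) (Inr y)"
      "\<And>x y. d2 (Inl x) (Inr y) \<le> \<phi> (d1 (Inl x) (Inr y))"
    unfolding coarsely_equivalent_def by blast
  have "continuous_on {0..} \<phi>"
    using hom by (simp add: homeomorphism_def)
  with d1 have "M_metric d1 \<subseteq> M_metric d2"
    using le(2) by (rule M_metric_mono_upper_control)
  moreover have "M_metric d2 \<subseteq> M_metric d1"
    using d1 hom le(1) by (rule M_metric_mono_lower_control)
  ultimately show ?thesis ..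
qed

lemma metric_classes_subset: "c \<in> metric_classes \<Longrightarrow> c \<subseteq> union_metrics"
  by (auto simp: metric_classes_def quotient_def coarsely_equivalent_def)

text \<open>This justifies \<open>the_elem\<close> in \<open>M_class\<close>: each member of the
  class is compared with one fixed \<open>d0\<close>, so the image of the class under
  \<open>M_metric\<close> is a singleton.\<close>

lemma M_class_eq:
  assumes "c \<in> metric_classes" and "d \<in> c"
  shows "M_class c = M_metric d"
proof -
  obtain d0 where c: "c = coarsely_equivalent `` {d0}"
    using assms(1) by (auto simp: metric_classes_def quotient_def)
  have "M_metric d' = M_metric d0" if "d' \<in> c" for d'
    using that M_metric_coarsely_equivalent unfolding c by blast
  then have "M_metric ` c = {M_metric d}"
    using assms(2) by auto
  then show ?thesis
    by (simp add: M_class_def)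
qed

theorem lemma4p2:
  fixes c1 c2 :: "('x::metric_space, 'y::metric_space) sum_metric set"
  assumes "uniform_discrete (UNIV :: 'x set)" and "bounded_geometry TYPE('x)"
    and "uniform_discrete (UNIV :: 'y set)" and "bounded_geometry TYPE('y)"
    and "c1 \<in> metric_classes" and "c2 \<in> metric_classes"
    and "class_le c1 c2"
  shows "M_class c1 \<subseteq> M_class c2"
proof -
  from assms(7) obtain d1 d2 \<phi> \<psi> where d: "d1 \<in> c1" "d2 \<in> c2"
    and hom: "homeomorphism {0..} {0..} \<phi> \<psi>"
    and le: "\<And>x y. d2 (Inl x) (Inr y) \<le> \<phi> (d1 (Inl x) (Inr y))"
    unfolding class_le_def by blast
  have "d1 \<in> union_metrics"
    using metric_classes_subset assms(5) d(1) by blast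
  moreover have "continuous_on {0..} \<phi>"
    using hom by (simp add: homeomorphism_def)
  ultimately have "M_metric d1 \<subseteq> M_metric d2"
    using le by (rule M_metric_mono_upper_control)
  \<comment> \<open>\<open>class_le\<close> provides its own representatives \<open>d1\<close>,
    \<open>d2\<close>; \<open>M_class_eq\<close> permits evaluating both classes at exactly
    these.\<close>
  then show ?thesis
    using assms(5,6) d by (simp add: M_class_eq)
qed

end
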